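(* Let $k\ge1$ be an integer and $p\in(0,1)$. For the $k$-combinatorial assignment problem with agent arrivals, in which agents arrive in uniformly random order (each agent choosing an independent uniform arrival time in $(0,1)$), the Basic Online Assignment Algorithm with parameter $p$ (both described in the context) is $\int_p^1(p/t)^k\,dt$-competitive, i.e. its output satisfies $\mathbb{E}[w(\mathrm{ALG})]\ge\big(\int_p^1(p/t)^k\,dt\big)\,w(\mathrm{OPT}(A))$. By choosing appropriate values of $p$ for each $k$, the competitive ratio is $1/e$ for $k=1$ and $$k^{-k/(k-1)}=\frac1k-\frac{\ln k}{k^2}+O\!\left(\frac{\ln^2 k}{k^3}\right)\quad\text{for }k\ge2.$$
   Context: Problem ($k$-combinatorial assignment with agent arrivals): There is a finite set $A$ of agents, a finite set $R$ of goods, and a finite hypergraph $H=(A\cup R,E)$ in which each hyperedge $e$ contains exactly one agent $A(e)\in A$ and a set $R(e)\subseteq R$ of goods with $|R(e)|\le k$. For $a\in A$, $\delta(a)$ is the set of hyperedges containing $a$ (and $\delta(b)$ similarly for $b\in R$). Each agent $a$ has an independence system $(\delta(a),\mathcal{I}_a)$ ($\mathcal{I}_a$ a nonempty downward-closed family of subsets of $\delta(a)$), and $w:E\to\mathbb{R}_{\ge0}$ is a weight function, $w(F)=\sum_{e\in F}w(e)$. A set $F\subseteq E$ is feasible if $\delta(a)\cap F\in\mathcal{I}_a$ for all $a\in A$ and $|\delta(b)\cap F|\le1$ for all goods $b\in R$. When an agent $a$ arrives, the weights of all hyperedges in $\delta(a)$ are revealed, and a subset of $\delta(a)$ must be irrevocably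 selected so that the total selected set remains feasible. For $A'\subseteq A$, $\mathrm{OPT}(A')$ denotes a (fixed) maximum-weight feasible set of hyperedges among those whose agent is in $A'$. Basic Online Assignment Algorithm with parameter $p$: start with $\mathrm{ALG}=\emptyset$ and ignore all agents arriving before time $p$. For each agent $a$ arriving at time $t_a\in[p,1]$, in arrival order: let $A_a$ be the set of agents that have arrived up to time $t_a$ (including $a$ and those ignored); compute $\mathrm{OPT}(A_a)$ and let $F(a)=\mathrm{OPT}(A_a)\cap\delta(a)$; let $F'(a)=\{e\in F(a): R(e)\cap R(f)=\emptyset\text{ for all }f\in\mathrm{ALG}\}$; set $\mathrm{ALG}\leftarrow\mathrm{ALG}\cup F'(a)$. Return $\mathrm{ALG}$. *)

theory Defs
  imports "HOL-Probability.Probability" "HOL-Library.Landau_Symbols"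
begin

text \<open>
  The hypergraph has vertex set \<open>agents G \<union> goods G\<close>, and a hyperedge is the set of its vertices.
  The family \<open>indep G a\<close> is the independence system of agent \<open>a\<close>.
\<close>

record 'v assignment =
  agents :: "'v set"
  goods :: "'v set"
  edges :: "'v set set"
  indep :: "'v \<Rightarrow> 'v set set set"
  weight :: "'v set \<Rightarrow> real"

definition incident :: "'v assignment \<Rightarrow> 'v \<Rightarrow> 'v set set" where
  "incident G v = {e \<in> edges G. v \<in> e}"

definition agent_of :: "'v assignment \<Rightarrow> 'v set \<Rightarrow> 'v" where
  "agent_of G e = the_elem (e \<inter> agents G)"

definition goods_of :: "'v assignment \<Rightarrow> 'v set \<Rightarrow> 'v set" where
  "goods_of G e = e \<inter> goods G"

definition independence_system :: "'b set \<Rightarrow> 'b set set \<Rightarrow> bool" where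
  "independence_system S I \<longleftrightarrow>
     I \<noteq> {} \<and> I \<subseteq> Pow S \<and> (\<forall>X\<in>I. \<forall>Y. Y \<subseteq> X \<longrightarrow> Y \<in> I)"

definition combinatorial_assignment :: "nat \<Rightarrow> 'v assignment \<Rightarrow> bool" where
  "combinatorial_assignment k G \<longleftrightarrow>
     finite (agents G) \<and> finite (goods G) \<and> agents G \<inter> goods G = {} \<and>
     (\<forall>e\<in>edges G. e \<subseteq> agents G \<union> goods G \<and> card (e \<inter> agents G) = 1 \<and> card (goods_of G e) \<le> k) \<and>
     (\<forall>a\<in>agents G. independence_system (incident G a) (indep G a)) \<and>
     (\<forall>e\<in>edges G. weight G e \<ge> 0)"

definition total_weight :: "'v assignment \<Rightarrow> 'v set set \<Rightarrow> real" where
  "total_weight G F = (\<Sum>e\<in>F. weight G e)"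

definition feasible :: "'v assignment \<Rightarrow> 'v set set \<Rightarrow> bool" where
  "feasible G F \<longleftrightarrow> F \<subseteq> edges G \<and>
     (\<forall>a\<in>agents G. incident G a \<inter> F \<in> indep G a) \<and>
     (\<forall>b\<in>goods G. card (incident G b \<inter> F) \<le> 1)"

text \<open>
  A choice of one maximum-weight feasible set for every set of agents. The choice depends on the
  set of agents only, not on the order in which they arrived.
\<close>

definition optimum_choice :: "'v assignment \<Rightarrow> ('v set \<Rightarrow> 'v set set) \<Rightarrow> bool" where
  "optimum_choice G OPT \<longleftrightarrow>
     (\<forall>A'\<subseteq>agents G.
        is_arg_max (total_weight G) (\<lambda>F. feasible G F \<and> (\<forall>e\<in>F. agent_of G e \<in> A')) (OPT A'))"

text \<open>
  Simultaneous arrivals are put in some order that depends only on the relative order of the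
  arrival times; for independent uniform arrival times they have probability zero.
\<close>

definition arrival_order :: "('v \<Rightarrow> real) \<Rightarrow> 'v set \<Rightarrow> 'v list" where
  "arrival_order t A = (SOME as. distinct as \<and> set as = A \<and> sorted (map t as))"

definition arrived :: "'v assignment \<Rightarrow> ('v \<Rightarrow> real) \<Rightarrow> real \<Rightarrow> 'v set" where
  "arrived G t s = {a \<in> agents G. t a \<le> s}"

definition assign_step ::
  "'v assignment \<Rightarrow> ('v set \<Rightarrow> 'v set set) \<Rightarrow> real \<Rightarrow> ('v \<Rightarrow> real) \<Rightarrow> 'v set set \<Rightarrow> 'v \<Rightarrow> 'v set set" where
  "assign_step G OPT p t ALG a =
     (if t a \<in> {p..1}
      then ALG \<union> {e \<in> OPT (arrived G t (t a)) \<inter> incident G a.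
                    \<forall>f\<in>ALG. goods_of G e \<inter> goods_of G f = {}}
      else ALG)"

definition basic_assignment ::
  "'v assignment \<Rightarrow> ('v set \<Rightarrow> 'v set set) \<Rightarrow> real \<Rightarrow> ('v \<Rightarrow> real) \<Rightarrow> 'v set set" where
  "basic_assignment G OPT p t = foldl (assign_step G OPT p t) {} (arrival_order t (agents G))"

definition uniform_arrivals :: "'w measure \<Rightarrow> 'v set \<Rightarrow> ('v \<Rightarrow> 'w \<Rightarrow> real) \<Rightarrow> bool" where
  "uniform_arrivals M A T \<longleftrightarrow>
     prob_space M \<and> prob_space.indep_vars M (\<lambda>_. borel) T A \<and>
     (\<forall>a\<in>A. distr M borel (T a) = uniform_measure lborel {0<..<1})"

text \<open>
  The guarantee ranges over all instances with parameter \<open>k\<close>, all choices of optima and all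
  probability spaces, with \<open>p\<close> and \<open>c\<close> fixed beforehand. The type arguments only name the types
  of the vertices and of the outcomes.
\<close>

definition basic_assignment_competitive ::
  "'v itself \<Rightarrow> 'w itself \<Rightarrow> nat \<Rightarrow> real \<Rightarrow> real \<Rightarrow> bool" where
  "basic_assignment_competitive V W k p c \<longleftrightarrow>
     (\<forall>(G :: 'v assignment) OPT (M :: 'w measure) T.
        combinatorial_assignment k G \<longrightarrow> optimum_choice G OPT \<longrightarrow>
        uniform_arrivals M (agents G) T \<longrightarrow>
        (\<forall>\<omega>\<in>space M. feasible G (basic_assignment G OPT p (\<lambda>a. T a \<omega>))) \<and>
        (\<integral>\<omega>. total_weight G (basic_assignment G OPT p (\<lambda>a. T a \<omega>)) \<partial>M)
          \<ge> c * total_weight G (OPT (agents G)))"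

definition basic_ratio :: "nat \<Rightarrow> real \<Rightarrow> real" where
  "basic_ratio k p = integral {p..1} (\<lambda>t. (p / t) ^ k)"

end

theory Submission
  imports Defs "HOL-Real_Asymp.Real_Asymp"
begin

text \<open>
  Given that exactly the agents of \<open>B\<close> have arrived when \<open>a \<in> B\<close> arrives at time \<open>s\<close>, the other
  agents of \<open>B\<close> are independent and uniform on \<open>(0, s)\<close>. An edge \<open>e \<in> OPT B\<close> of \<open>a\<close> is selected
  unless an earlier agent \<open>b\<close>, arriving after \<open>p\<close>, could have taken one of the goods of \<open>e\<close>. Going
  backwards in time, the last of \<open>m\<close> agents is uniformly distributed among them and at most \<open>k\<close>
  of them own a good of \<open>e\<close> in the current optimum; so \<open>e\<close> is available with probability at least
  \<open>(p/s)^k\<close>. Summed over all agents, the tentative selections at time \<open>s\<close> have expected weight at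
  least \<open>w(OPT(A))\<close>, because the agents present at time \<open>s\<close> carry an expected fraction \<open>s\<close> of
  the optimum, and the last arrival is uniform among them with intensity \<open>1/s\<close>. Integrating over \<open>s\<close>
  gives the guarantee, and \<open>p = k powr (-1/(k-1))\<close> maximizes it.
\<close>

subsection \<open>The algorithm\<close>

lemma
  assumes "finite A"
  shows distinct_arrival_order: "distinct (arrival_order t A)"
    and set_arrival_order: "set (arrival_order t A) = A"
    and sorted_arrival_order: "sorted (map t (arrival_order t A))"
proof -
  obtain xs where "set xs = A" "distinct xs"
    using finite_distinct_list[OF assms] by blast
  then have "distinct (sort_key t xs) \<and> set (sort_key t xs) = A \<and> sorted (map t (sort_key t xs))"
    by simp
  then have "distinct (arrival_order t A) \<and> set (arrival_order t A) = A
      \<and> sorted (map t (arrival_order t A))"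
    unfolding arrival_order_def by (rule someI)
  then show "distinct (arrival_order t A)" "set (arrival_order t A) = A"
    "sorted (map t (arrival_order t A))" by auto
qed

text \<open>Sortedness only sees comparisons of times, so both \<open>SOME\<close> terms choose from
  the same predicate and return the same list, even when times coincide.\<close>

lemma arrival_order_cong:
  assumes "\<And>a b. a \<in> A \<Longrightarrow> b \<in> A \<Longrightarrow> x a \<le> x b \<longleftrightarrow> y a \<le> y b"
  shows "arrival_order x A = arrival_order y A"
proof -
  have "sorted (map x as) \<longleftrightarrow> sorted (map y as)" if "set as = A" for as
    using that assms by (auto simp: sorted_wrt_map intro: sorted_wrt_mono_rel[rotated])
  then show ?thesis
    unfolding arrival_order_def by metis
qed

lemma assign_step_mono: "F \<subseteq> assign_step G OPT p t F a"
  by (auto simp: assign_step_def)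

lemma foldl_assign_step_mono: "F \<subseteq> foldl (assign_step G OPT p t) F as"
proof (induction as arbitrary: F)
  case (Cons a as)
  then show ?case
    using assign_step_mono[of F G OPT p t a] by fastforce
qed simp

section \<open>Feasible sets and optima of an instance\<close>

locale assignment_instance =
  fixes k :: nat and G :: "'v assignment" and OPT :: "'v set \<Rightarrow> 'v set set"
  assumes combinatorial: "combinatorial_assignment k G"
    and optimum: "optimum_choice G OPT"
begin

lemma finite_agents: "finite (agents G)"
  and finite_goods: "finite (goods G)"
  and edge_subset: "e \<in> edges G \<Longrightarrow> e \<subseteq> agents G \<union> goods G"
  and card_goods_of: "e \<in> edges G \<Longrightarrow> card (goods_of G e) \<le> k"
  and weight_nonneg: "e \<in> edges G \<Longrightarrow> 0 \<le> weight G e"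
  using combinatorial by (auto simp: combinatorial_assignment_def)

lemma finite_edges: "finite (edges G)"
  by (rule finite_subset[of _ "Pow (agents G \<union> goods G)"])
    (use edge_subset finite_agents finite_goods in auto)

lemma edge_agents:
  assumes "e \<in> edges G"
  shows "e \<inter> agents G = {agent_of G e}"
proof -
  have "card (e \<inter> agents G) = 1"
    using combinatorial assms by (auto simp: combinatorial_assignment_def)
  then obtain a where "e \<inter> agents G = {a}"
    by (auto simp: card_1_singleton_iff)
  then show ?thesis
    by (simp add: agent_of_def)
qed

lemma agent_of_in_agents: "e \<in> edges G \<Longrightarrow> agent_of G e \<in> agents G"
  using edge_agents by blast

lemma incident_iff:
  assumes "a \<in> agents G"
  shows "e \<in> incident G a \<longleftrightarrow> e \<in> edges G \<and> agent_of G e = a"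
proof (cases "e \<in> edges G")
  case True
  have "a \<in> e \<longleftrightarrow> a \<in> e \<inter> agents G"
    using assms by simp
  then show ?thesis
    unfolding edge_agents[OF True] using True by (auto simp: incident_def)
qed (simp add: incident_def)

lemma indep_subset:
  "a \<in> agents G \<Longrightarrow> X \<in> indep G a \<Longrightarrow> Y \<subseteq> X \<Longrightarrow> Y \<in> indep G a"
  using combinatorial by (auto simp: combinatorial_assignment_def independence_system_def)

lemma empty_indep: "a \<in> agents G \<Longrightarrow> {} \<in> indep G a"
  using combinatorial by (fastforce simp: combinatorial_assignment_def independence_system_def)

lemma feasible_subset:
  assumes "feasible G F" "F' \<subseteq> F"
  shows "feasible G F'"
  unfolding feasible_def
proof (intro conjI ballI)
  show "F' \<subseteq> edges G"
    using assms by (auto simp: feasible_def)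
  show "incident G a \<inter> F' \<in> indep G a" if "a \<in> agents G" for a
    using assms that indep_subset[of a "incident G a \<inter> F" "incident G a \<inter> F'"]
    by (auto simp: feasible_def)
  show "card (incident G b \<inter> F') \<le> 1" if "b \<in> goods G" for b
  proof -
    have "finite (incident G b \<inter> F)"
      using finite_edges by (auto simp: incident_def intro: finite_subset)
    then have "card (incident G b \<inter> F') \<le> card (incident G b \<inter> F)"
      using assms(2) by (intro card_mono) auto
    then show ?thesis
      using assms(1) that by (force simp: feasible_def)
  qed
qed

lemma
  assumes "B \<subseteq> agents G"
  shows feasible_OPT: "feasible G (OPT B)"
    and agent_of_OPT: "e \<in> OPT B \<Longrightarrow> agent_of G e \<in> B"
    and total_weight_le_OPT: "feasible G F \<Longrightarrow> (\<And>e. e \<in> F \<Longrightarrow> agent_of G e \<in> B)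
      \<Longrightarrow> total_weight G F \<le> total_weight G (OPT B)"
proof -
  have "is_arg_max (total_weight G) (\<lambda>F. feasible G F \<and> (\<forall>e\<in>F. agent_of G e \<in> B)) (OPT B)"
    using optimum assms by (simp add: optimum_choice_def)
  then show "feasible G (OPT B)" "e \<in> OPT B \<Longrightarrow> agent_of G e \<in> B"
    "feasible G F \<Longrightarrow> (\<And>e. e \<in> F \<Longrightarrow> agent_of G e \<in> B)
      \<Longrightarrow> total_weight G F \<le> total_weight G (OPT B)"
    by (auto simp: is_arg_max_def not_less)
qed

lemma OPT_subset: "B \<subseteq> agents G \<Longrightarrow> OPT B \<subseteq> edges G"
  using feasible_OPT by (auto simp: feasible_def)

lemma feasible_good_unique:
  assumes "feasible G F" "e \<in> F" "f \<in> F" "r \<in> goods_of G e" "r \<in> goods_of G f"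
  shows "e = f"
proof -
  have "card (incident G r \<inter> F) \<le> 1"
    using assms by (auto simp: feasible_def goods_of_def)
  moreover have "finite (incident G r \<inter> F)"
    using finite_edges by (auto simp: incident_def intro: finite_subset)
  moreover have "e \<in> incident G r \<inter> F" "f \<in> incident G r \<inter> F"
    using assms by (auto simp: incident_def goods_of_def feasible_def)
  ultimately show ?thesis
    by (metis One_nat_def card_le_Suc0_iff_eq)
qed

text \<open>The edges of \<open>b\<close> in \<open>OPT B\<close> count whether or not the algorithm
  could take them. The notion thus depends on \<open>B\<close> and not on the history of
  \<open>ALG\<close>, at the price of overestimating conflicts.\<close>

definition blocks :: "'v set \<Rightarrow> 'v \<Rightarrow> 'v set \<Rightarrow> bool" where
  "blocks e b B \<longleftrightarrow> (\<exists>f\<in>OPT B. agent_of G f = b \<and> goods_of G e \<inter> goods_of G f \<noteq> {})"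

text \<open>
  Distinct blocking agents own distinct goods of \<open>e\<close> in \<open>OPT B\<close>.
\<close>

lemma card_blocks_le:
  assumes "B \<subseteq> agents G" "e \<in> edges G"
  shows "card {b \<in> B. blocks e b B} \<le> k"
proof -
  define owner where
    "owner r = agent_of G (SOME f. f \<in> OPT B \<and> r \<in> goods_of G f)" for r
  have "b \<in> owner ` goods_of G e" if block: "blocks e b B" for b
  proof -
    obtain f r where f: "f \<in> OPT B" "agent_of G f = b" "r \<in> goods_of G e" "r \<in> goods_of G f"
      using block by (auto simp: blocks_def)
    have eq: "g = f" if "g \<in> OPT B \<and> r \<in> goods_of G g" for g
      using feasible_good_unique[OF feasible_OPT[OF assms(1)], of g f r] that f by simp
    have "(SOME f. f \<in> OPT B \<and> r \<in> goods_of G f) = f"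
      by (rule some_equality) (simp add: f, rule eq)
    then have "b = owner r"
      using f(2) by (simp add: owner_def)
    then show ?thesis
      using f(3) by blast
  qed
  then have "{b \<in> B. blocks e b B} \<subseteq> owner ` goods_of G e"
    by auto
  moreover have "finite (goods_of G e)"
    using finite_goods by (simp add: goods_of_def)
  ultimately have "card {b \<in> B. blocks e b B} \<le> card (goods_of G e)"
    by (meson surj_card_le)
  then show ?thesis
    using card_goods_of[OF assms(2)] by simp
qed

section \<open>Runs of the algorithm\<close>

lemma arrived_subset: "arrived G t s \<subseteq> agents G"
  by (auto simp: arrived_def)

text \<open>Invariant along any list of processed agents, so that it covers the full run as well as
  its prefixes. Recording the optimum that each selected edge came from is what later ties selected
  edges to \<open>blocks\<close>.\<close>

lemma assign_run:
  fixes p :: real and t :: "'v \<Rightarrow> real"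
  assumes "distinct as" "set as \<subseteq> agents G"
  defines "F \<equiv> foldl (assign_step G OPT p t) {} as"
  shows "feasible G F \<and>
    (\<forall>f\<in>F. agent_of G f \<in> set as \<and> p \<le> t (agent_of G f)
      \<and> f \<in> OPT (arrived G t (t (agent_of G f))))"
  using assms(1,2) unfolding F_def
proof (induction as rule: rev_induct)
  case Nil
  then show ?case
    by (auto simp: feasible_def empty_indep)
next
  case (snoc a as)
  define F where "F = foldl (assign_step G OPT p t) {} as"
  define B where "B = arrived G t (t a)"
  define N where "N = {e \<in> OPT B \<inter> incident G a. \<forall>f\<in>F. goods_of G e \<inter> goods_of G f = {}}"
  have a: "a \<in> agents G" "a \<notin> set as"
    using snoc.prems by auto
  have F: "feasible G F" and run: "\<And>f. f \<in> F \<Longrightarrow> agent_of G f \<in> set as \<and> p \<le> t (agent_of G f)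
      \<and> f \<in> OPT (arrived G t (t (agent_of G f)))"
    using snoc by (auto simp: F_def)
  have step: "foldl (assign_step G OPT p t) {} (as @ [a]) = (if t a \<in> {p..1} then F \<union> N else F)"
    by (simp add: assign_step_def N_def F_def B_def)
  have B: "B \<subseteq> agents G"
    by (simp add: B_def arrived_subset)
  have N: "feasible G N"
    by (rule feasible_subset[OF feasible_OPT[OF B]]) (auto simp: N_def)
  have N_agent: "agent_of G e = a" if "e \<in> N" for e
    using that a incident_iff by (auto simp: N_def)
  have F_agent: "agent_of G e \<noteq> a" if "e \<in> F" for e
    using run[OF that] a by auto
  have "feasible G (F \<union> N)"
    unfolding feasible_def
  proof (intro conjI ballI)
    show "F \<union> N \<subseteq> edges G"
      using F N by (auto simp: feasible_def)
    show "incident G c \<inter> (F \<union> N) \<in> indep G c" if "c \<in> agents G" for c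
    proof -
      \<comment> \<open>Since \<open>a\<close> is not in \<open>as\<close>, all selected edges of
        one agent stem from a single step, so independence is never tested on a mixture of
        \<open>F\<close> and \<open>N\<close>.\<close>
      have "incident G c \<inter> (F \<union> N) = (if c = a then incident G c \<inter> N else incident G c \<inter> F)"
        using N_agent F_agent incident_iff[OF that] by auto
      then show ?thesis
        using F N that by (auto simp: feasible_def)
    qed
    show "card (incident G b \<inter> (F \<union> N)) \<le> 1" if "b \<in> goods G" for b
    proof -
      have fin: "finite (incident G b \<inter> (F \<union> N))"
        using finite_edges by (auto simp: incident_def intro: finite_subset)
      have "e = f" if "e \<in> incident G b \<inter> (F \<union> N)" "f \<in> incident G b \<inter> (F \<union> N)" for e f
      proof -
        have b: "b \<in> goods_of G e" "b \<in> goods_of G f"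
          using that \<open>b \<in> goods G\<close> by (auto simp: incident_def goods_of_def)
        \<comment> \<open>A shared good puts both edges on the same side, because \<open>N\<close>
          avoids the goods of \<open>F\<close>; feasibility of that side then applies.\<close>
        then show ?thesis
          using that feasible_good_unique[OF F _ _ b] feasible_good_unique[OF N _ _ b]
          by (auto simp: N_def)
      qed
      then show ?thesis
        using fin by (metis One_nat_def card_le_Suc0_iff_eq)
    qed
  qed
  moreover have "agent_of G f \<in> set (as @ [a]) \<and> p \<le> t (agent_of G f)
      \<and> f \<in> OPT (arrived G t (t (agent_of G f)))" if "f \<in> F \<union> N" "t a \<in> {p..1}" for f
    using that run N_agent by (auto simp: N_def B_def)
  moreover have "agent_of G f \<in> set (as @ [a])" if "f \<in> F" for f
    using run[OF that] by simp
  ultimately show ?case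
    using F run unfolding step by (cases "t a \<in> {p..1}") (simp_all del: atLeastAtMost_iff)
qed

lemma feasible_basic_assignment: "feasible G (basic_assignment G OPT p t)"
  using assign_run[of "arrival_order t (agents G)" p t]
    distinct_arrival_order[OF finite_agents] set_arrival_order[OF finite_agents]
  by (simp add: basic_assignment_def)

text \<open>Any edge already in \<open>ALG\<close> when \<open>a\<close> is processed lies in the
  optimum at the arrival of its own agent, not before \<open>p\<close>. Sharing a good with
  \<open>e\<close> would make that agent a blocker; and later steps discard nothing.\<close>

lemma selected_if_unblocked:
  assumes e: "e \<in> OPT (arrived G t (t a))" "agent_of G e = a"
    and a: "a \<in> agents G" "p \<le> t a" "t a \<le> 1"
    and unblocked: "\<And>b. b \<in> arrived G t (t a) - {a} \<Longrightarrow> p \<le> t b \<Longrightarrow> \<not> blocks e b (arrived G t (t b))"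
  shows "e \<in> basic_assignment G OPT p t"
proof -
  let ?as = "arrival_order t (agents G)"
  note order = distinct_arrival_order[OF finite_agents, of t] set_arrival_order[OF finite_agents, of t]
    sorted_arrival_order[OF finite_agents, of t]
  obtain us vs where as: "?as = us @ a # vs"
    using a(1) order(2) by (metis split_list)
  define F where "F = foldl (assign_step G OPT p t) {} us"
  have us: "distinct us" "set us \<subseteq> agents G" "a \<notin> set us"
    using order unfolding as by auto
  have "goods_of G e \<inter> goods_of G f = {}" if "f \<in> F" for f
  proof -
    let ?b = "agent_of G f"
    have f: "?b \<in> set us" "p \<le> t ?b" "f \<in> OPT (arrived G t (t ?b))"
      using assign_run[OF us(1,2), of p t] that by (auto simp: F_def)
    moreover have "t ?b \<le> t a"
      using order(3) f(1) unfolding as by (auto simp: sorted_append)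
    ultimately have "\<not> blocks e ?b (arrived G t (t ?b))"
      using unblocked[of ?b] us by (auto simp: arrived_def)
    then show ?thesis
      using f(3) by (auto simp: blocks_def)
  qed
  moreover have "e \<in> incident G a"
    using e a OPT_subset[OF arrived_subset] incident_iff by blast
  ultimately have "e \<in> assign_step G OPT p t F a"
    using e a by (auto simp: assign_step_def)
  then show ?thesis
    using foldl_assign_step_mono[of "assign_step G OPT p t F a" G OPT p t vs]
    by (auto simp: basic_assignment_def as F_def)
qed

text \<open>The run consults the times only through comparisons and membership in
  \<open>{p..1}\<close>. The output is thus determined by finitely many bits, which is the source of
  its measurability.\<close>

lemma basic_assignment_cong:
  assumes order: "\<And>a b. a \<in> agents G \<Longrightarrow> b \<in> agents G \<Longrightarrow> x a \<le> x b \<longleftrightarrow> y a \<le> y b"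
    and active: "\<And>a. a \<in> agents G \<Longrightarrow> x a \<in> {p..1} \<longleftrightarrow> y a \<in> {p..1}"
  shows "basic_assignment G OPT p x = basic_assignment G OPT p y"
proof -
  have "assign_step G OPT p x F a = assign_step G OPT p y F a" if "a \<in> agents G" for F a
  proof -
    have "arrived G x (x a) = arrived G y (y a)"
      using order that by (auto simp: arrived_def)
    then show ?thesis
      using active[OF that] by (simp add: assign_step_def)
  qed
  then have "foldl (assign_step G OPT p x) F as = foldl (assign_step G OPT p y) F as"
    if "set as \<subseteq> agents G" for as F
    using that by (induction as arbitrary: F) auto
  then show ?thesis
    using arrival_order_cong[of "agents G" x y] order set_arrival_order[OF finite_agents, of y]
    by (simp add: basic_assignment_def)
qed

end

subsection \<open>Uniform arrival times\<close>

abbreviation uniform01 :: "real measure" where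
  "uniform01 \<equiv> uniform_measure lborel {0<..<1}"

interpretation uniform01: prob_space uniform01
  by (rule prob_space_uniform_measure) auto

interpretation arrivals: product_sigma_finite "\<lambda>_. uniform01"
  by unfold_locales

lemma emeasure_uniform01_lessThan:
  assumes "0 \<le> t" "t \<le> 1"
  shows "emeasure uniform01 {..<t} = ennreal t"
proof -
  have "{0<..<1} \<inter> {..<t} = {0<..<t}"
    using assms by auto
  then show ?thesis
    using assms by (simp add: divide_ennreal_def)
qed

lemma emeasure_uniform01_greaterThan:
  assumes "0 \<le> t" "t \<le> 1"
  shows "emeasure uniform01 {t<..} = ennreal (1 - t)"
proof -
  have "{0<..<1} \<inter> {t<..} = {t<..<1}"
    using assms by auto
  then show ?thesis
    using assms by (simp add: divide_ennreal_def)
qed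

lemma nn_integral_uniform01:
  assumes "f \<in> borel_measurable borel"
  shows "(\<integral>\<^sup>+x. f x \<partial>uniform01) = (\<integral>\<^sup>+x. f x * indicator {0<..<1} x \<partial>lborel)"
  using assms by (simp add: nn_integral_uniform_measure divide_ennreal_def)

text \<open>Bridge from Henstock-Kurzweil integrals to probabilities: the density is 1 on the part
  of \<open>{p..t}\<close> inside the open unit interval.\<close>

lemma nn_integral_uniform01_ge:
  assumes f: "f \<in> borel_measurable borel" and g: "(g has_integral I) {p..t}"
    and nonneg: "\<And>s. s \<in> {p..t} \<Longrightarrow> 0 \<le> g s"
    and ge: "\<And>s. p \<le> s \<Longrightarrow> s < t \<Longrightarrow> ennreal (g s) \<le> f s"
    and "0 < p" "t \<le> 1"
  shows "ennreal I \<le> (\<integral>\<^sup>+s. f s \<partial>uniform01)"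
proof -
  have "ennreal I = (\<integral>\<^sup>+s. ennreal (g s) * indicator {p..t} s \<partial>lborel)"
    by (rule nn_integral_has_integral_lebesgue'[OF nonneg g, symmetric])
  also have "\<dots> \<le> (\<integral>\<^sup>+s. f s * indicator {0<..<1} s \<partial>lborel)"
  proof (rule nn_integral_mono_AE)
    \<comment> \<open>The end point has to be removed: \<open>ge\<close> does not cover it, and for
      \<open>t = 1\<close> it lies outside the support.\<close>
    have "AE s in lborel. s \<noteq> t"
      by (rule AE_lborel_singleton)
    then show "AE s in lborel. ennreal (g s) * indicator {p..t} s \<le> f s * indicator {0<..<1} s"
    proof eventually_elim
      case (elim s)
      then show ?case
        using ge[of s] assms(5,6) by (auto split: split_indicator)
    qed
  qed
  finally show ?thesis
    using f by (simp add: nn_integral_uniform01)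
qed

text \<open>Edge and optimum are abstracted into \<open>blk\<close>, so that the estimates only need
  a bound on the number of blockers in each set. Arrival of all of \<open>S\<close> before
  \<open>t\<close> is part of the event, whose probability is therefore a joint one; this is where
  the factor \<open>t ^ card S\<close> comes from.\<close>

definition unblocked ::
  "('v \<Rightarrow> 'v set \<Rightarrow> bool) \<Rightarrow> real \<Rightarrow> 'v set \<Rightarrow> real \<Rightarrow> ('v \<Rightarrow> real) \<Rightarrow> bool" where
  "unblocked blk p S t x \<longleftrightarrow> (\<forall>b\<in>S. x b < t) \<and>
     (\<forall>b\<in>S. p \<le> x b \<longrightarrow> \<not> blk b {c \<in> S. x c \<le> x b})"

lemma unblocked_cong:
  assumes "\<And>c. c \<in> S \<Longrightarrow> x c = y c"
  shows "unblocked blk p S t x \<longleftrightarrow> unblocked blk p S t y"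
proof -
  have "{c \<in> S. x c \<le> x b} = {c \<in> S. y c \<le> y b}" if "b \<in> S" for b
    using assms that by auto
  then show ?thesis
    using assms by (auto simp: unblocked_def)
qed

text \<open>The agents of \<open>S\<close> arrive strictly before \<open>b\<close> and so never see
  \<open>b\<close>, while \<open>b\<close> sees all of \<open>insert b S\<close>. This is the
  recursion that goes backwards over the last arrival.\<close>

lemma unblocked_insert_last:
  assumes "b \<notin> S" "p \<le> x b" "x b < t"
    and "\<not> blk b (insert b S)" "unblocked blk p S (x b) x"
  shows "unblocked blk p (insert b S) t x"
proof -
  have lt: "x c < x b" if "c \<in> S" for c
    using assms that by (auto simp: unblocked_def)
  then have "{c \<in> insert b S. x c \<le> x b} = insert b S"
    by (auto intro: less_imp_le)
  moreover have "{c \<in> insert b S. x c \<le> x d} = {c \<in> S. x c \<le> x d}" if "d \<in> S" for d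
    using lt[OF that] by auto
  ultimately show ?thesis
    using assms lt by (force simp: unblocked_def)
qed

text \<open>The bound \<open>t\<close> may depend on the sample point, because it will be the
  arrival time of another agent.\<close>

lemma unblocked_pred_measurable:
  assumes "finite S" and [measurable]: "t \<in> borel_measurable N"
    and X: "\<And>b. b \<in> S \<Longrightarrow> (\<lambda>x. X x b) \<in> borel_measurable N"
  shows "Measurable.pred N (\<lambda>x. unblocked blk p S (t x) (X x))"
proof -
  have le [measurable]: "Measurable.pred N (\<lambda>x. X x c \<le> X x b)" if "b \<in> S" "c \<in> S" for b c
    using X[OF that(1)] X[OF that(2)] by measurable
  have early [measurable]: "Measurable.pred N (\<lambda>x. X x b < t x)" if "b \<in> S" for b
    using X[OF that] by measurable
  have late [measurable]: "Measurable.pred N (\<lambda>x. p \<le> X x b)" if "b \<in> S" for b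
    using X[OF that] by measurable
  \<comment> \<open>The second argument of \<open>blk\<close> is a random set. Enumerating its
    finitely many values leaves a finite combination of comparisons.\<close>
  have select: "\<not> blk b {c \<in> S. X x c \<le> X x b} \<longleftrightarrow>
      (\<forall>B\<in>Pow S. (\<forall>c\<in>S. X x c \<le> X x b \<longleftrightarrow> c \<in> B) \<longrightarrow> \<not> blk b B)" for x b
  proof -
    have "(\<forall>c\<in>S. X x c \<le> X x b \<longleftrightarrow> c \<in> B) \<longleftrightarrow> B = {c \<in> S. X x c \<le> X x b}" if "B \<in> Pow S" for B
      using that by auto
    then show ?thesis
      by auto
  qed
  have "Measurable.pred N (\<lambda>x. \<forall>b\<in>S. X x b < t x)"
    by (intro pred_intros_finite assms(1) early)
  moreover have "Measurable.pred N (\<lambda>x. p \<le> X x b \<longrightarrow>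
      (\<forall>B\<in>Pow S. (\<forall>c\<in>S. X x c \<le> X x b \<longleftrightarrow> c \<in> B) \<longrightarrow> \<not> blk b B))" if "b \<in> S" for b
  proof -
    have "Measurable.pred N (\<lambda>x. \<forall>B\<in>Pow S. (\<forall>c\<in>S. X x c \<le> X x b \<longleftrightarrow> c \<in> B) \<longrightarrow> \<not> blk b B)"
      using assms(1) le[OF that] by (intro pred_intros_finite pred_intros_logic) auto
    then show ?thesis
      using late[OF that] by (intro pred_intros_logic) auto
  qed
  then have "Measurable.pred N (\<lambda>x. \<forall>b\<in>S. p \<le> X x b \<longrightarrow>
      (\<forall>B\<in>Pow S. (\<forall>c\<in>S. X x c \<le> X x b \<longleftrightarrow> c \<in> B) \<longrightarrow> \<not> blk b B))"
    using assms(1) by (intro pred_intros_finite) auto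
  ultimately show ?thesis
    unfolding unblocked_def select by (rule pred_intros_logic)
qed

lemma unblocked_sets:
  assumes "finite S"
  shows "{x \<in> space (PiM S (\<lambda>_. uniform01)). unblocked blk p S t x} \<in> sets (PiM S (\<lambda>_. uniform01))"
  using unblocked_pred_measurable[OF assms, of "\<lambda>_. t" "PiM S (\<lambda>_. uniform01)" "\<lambda>x. x"]
  by (simp add: pred_def measurable_component_singleton)

section \<open>The product space of arrival times\<close>

abbreviation arrival_space :: "'v set \<Rightarrow> ('v \<Rightarrow> real) measure" where
  "arrival_space I \<equiv> PiM I (\<lambda>_. uniform01)"

text \<open>Fubini in coordinate \<open>i\<close>: fix its value \<open>s\<close>, bound the
  probability of the remaining event below by \<open>g s\<close>, and integrate over
  \<open>s\<close>. By \<open>upd\<close>, that event only concerns the other coordinates.\<close>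

lemma emeasure_insert_ge:
  assumes I: "finite I" "i \<notin> I"
    and sets: "{x \<in> space (arrival_space (insert i I)). Q (x i) x} \<in> sets (arrival_space (insert i I))"
    and upd: "\<And>x y z. Q y (x(i := z)) \<longleftrightarrow> Q y x"
    and g: "(g has_integral r) {p..t}" "\<And>s. s \<in> {p..t} \<Longrightarrow> 0 \<le> g s"
    and ge: "\<And>s. p \<le> s \<Longrightarrow> s < t \<Longrightarrow>
      ennreal (g s) \<le> emeasure (arrival_space I) {x \<in> space (arrival_space I). Q s x}"
    and "0 < p" "t \<le> 1"
  shows "ennreal r \<le> emeasure (arrival_space (insert i I))
    {x \<in> space (arrival_space (insert i I)). Q (x i) x}"
proof -
  let ?E = "{x \<in> space (arrival_space (insert i I)). Q (x i) x}"
  define f where "f y = (\<integral>\<^sup>+x. indicator ?E (x(i := y)) \<partial>arrival_space I)" for y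
  have ind: "(indicator ?E :: _ \<Rightarrow> ennreal) \<in> borel_measurable (arrival_space (insert i I))"
    using sets by (rule borel_measurable_indicator)
  interpret I: finite_product_sigma_finite "\<lambda>_. uniform01" I
    by standard (rule I(1))
  have "(\<lambda>(y, x). x(i := y)) \<in> uniform01 \<Otimes>\<^sub>M arrival_space I \<rightarrow>\<^sub>M arrival_space (insert i I)"
    unfolding case_prod_beta by (rule measurable_fun_upd[where J = I]) auto
  from measurable_compose[OF this ind]
  have "(\<lambda>(y, x). indicator ?E (x(i := y)) :: ennreal) \<in> borel_measurable (uniform01 \<Otimes>\<^sub>M arrival_space I)"
    by (simp add: case_prod_beta)
  then have "f \<in> borel_measurable uniform01"
    unfolding f_def by (rule I.borel_measurable_nn_integral)
  then have f: "f \<in> borel_measurable borel"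
    by simp
  have f_eq: "f y = emeasure (arrival_space I) {x \<in> space (arrival_space I). Q y x}" for y
  proof -
    let ?u = "\<lambda>x. x(i := y)"
    have u: "?u \<in> arrival_space I \<rightarrow>\<^sub>M arrival_space (insert i I)"
      by (rule measurable_fun_upd[where J = I]) auto
    note space = measurable_space[OF u]
    have "?u -` ?E \<inter> space (arrival_space I) \<in> sets (arrival_space I)"
      by (rule measurable_sets[OF u sets])
    moreover have "?u -` ?E \<inter> space (arrival_space I) = {x \<in> space (arrival_space I). Q y x}"
      using space by (auto simp: upd)
    moreover have "f y = (\<integral>\<^sup>+x. indicator {x \<in> space (arrival_space I). Q y x} x \<partial>arrival_space I)"
      unfolding f_def using space by (intro nn_integral_cong) (auto simp: indicator_def upd)
    ultimately show ?thesis
      by simp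
  qed
  have "ennreal r \<le> (\<integral>\<^sup>+y. f y \<partial>uniform01)"
    by (rule nn_integral_uniform01_ge[OF f g]) (use ge assms(8,9) in \<open>simp_all add: f_eq\<close>)
  also have "\<dots> = (\<integral>\<^sup>+x. indicator ?E x \<partial>arrival_space (insert i I))"
    unfolding f_def by (rule arrivals.product_nn_integral_insert_rev[OF I ind, symmetric])
  also have "\<dots> = emeasure (arrival_space (insert i I)) ?E"
    using sets by (rule nn_integral_indicator)
  finally show ?thesis .
qed

lemma emeasure_all_lessThan:
  assumes "finite S" "0 \<le> t" "t \<le> 1"
  shows "emeasure (arrival_space S) {x \<in> space (arrival_space S). \<forall>b\<in>S. x b < t} = ennreal (t ^ card S)"
proof -
  have "{x \<in> space (arrival_space S). \<forall>b\<in>S. x b < t} = Pi\<^sub>E S (\<lambda>_. {..<t})"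
    by (auto simp: space_PiM PiE_def Pi_def)
  then show ?thesis
    using assms arrivals.emeasure_PiM[OF assms(1), of "\<lambda>_. {..<t}"]
    by (simp add: emeasure_uniform01_lessThan ennreal_power del: emeasure_uniform_measure)
qed

lemma emeasure_all_greaterThan:
  assumes "finite S" "0 \<le> t" "t \<le> 1"
  shows "emeasure (arrival_space S) {x \<in> space (arrival_space S). \<forall>b\<in>S. t < x b} = ennreal ((1 - t) ^ card S)"
proof -
  have "{x \<in> space (arrival_space S). \<forall>b\<in>S. t < x b} = Pi\<^sub>E S (\<lambda>_. {t<..})"
    by (auto simp: space_PiM PiE_def Pi_def)
  then show ?thesis
    using assms arrivals.emeasure_PiM[OF assms(1), of "\<lambda>_. {t<..}"]
    by (simp add: emeasure_uniform01_greaterThan ennreal_power del: emeasure_uniform_measure)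
qed

lemma has_integral_power_mult:
  fixes p t c :: real
  assumes "p \<le> t"
  shows "((\<lambda>s. c * s ^ n) has_integral c * (t ^ Suc n - p ^ Suc n) / real (Suc n)) {p..t}"
proof -
  have "((\<lambda>s. c * s ^ n) has_integral c * t ^ Suc n / real (Suc n) - c * p ^ Suc n / real (Suc n)) {p..t}"
    by (rule fundamental_theorem_of_calculus[OF assms])
      (auto intro!: derivative_eq_intros simp flip: has_real_derivative_iff_has_vector_derivative
        simp del: power_Suc of_nat_Suc)
  then show ?thesis
    by (simp add: diff_divide_distrib right_diff_distrib del: power_Suc of_nat_Suc)
qed

text \<open>
  Split by the last of the \<open>m\<close> agents of \<open>S\<close> to arrive and by its arrival time; at most \<open>k\<close> choices
  of this agent block. The bound \<open>t^m (p/t)^k\<close> solves the resulting integral recursion exactly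
  when \<open>m \<ge> k\<close>; for \<open>m \<le> k\<close> it suffices that everybody arrives before \<open>p\<close>.
\<close>

lemma emeasure_unblocked_ge:
  assumes "finite S" "\<And>B. B \<subseteq> S \<Longrightarrow> card {b \<in> B. blk b B} \<le> k" "0 < p" "p \<le> t" "t \<le> 1"
  shows "ennreal (t ^ card S * (p / t) ^ k)
    \<le> emeasure (arrival_space S) {x \<in> space (arrival_space S). unblocked blk p S t x}"
  using assms
proof (induction S arbitrary: t rule: finite_psubset_induct)
  case (psubset S)
  let ?M = "arrival_space S"
  define m where "m = card S"
  define early where "early = {x \<in> space ?M. \<forall>b\<in>S. x b < p}"
  have early_eq: "emeasure ?M early = ennreal (p ^ m)"
    using emeasure_all_lessThan[OF psubset.hyps, of p] psubset.prems by (simp add: early_def m_def)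
  have sets: "{x \<in> space ?M. unblocked blk p S t x} \<in> sets ?M"
    by (rule unblocked_sets[OF psubset.hyps])
  have early_sets: "early \<in> sets ?M"
    unfolding early_def using psubset.hyps by measurable
  have early_sub: "early \<subseteq> {x \<in> space ?M. unblocked blk p S t x}"
    using psubset.prems by (fastforce simp: early_def unblocked_def)
  show ?case
  proof (cases "m \<le> k")
    case True
    have "t ^ m * (p / t) ^ k \<le> t ^ m * (p / t) ^ m"
      using psubset.prems True by (intro mult_left_mono power_decreasing) auto
    also have "\<dots> = p ^ m"
      using psubset.prems by (simp add: power_divide)
    finally have "ennreal (t ^ m * (p / t) ^ k) \<le> emeasure ?M early"
      unfolding early_eq by (rule ennreal_leI)
    also have "\<dots> \<le> emeasure ?M {x \<in> space ?M. unblocked blk p S t x}"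
      by (rule emeasure_mono[OF early_sub sets])
    finally show ?thesis
      by (simp add: m_def)
  next
    case False
    \<comment> \<open>The candidates for the last arrival; the bound on blockers leaves at least
      \<open>m - k = n + 1\<close> of them.\<close>
    define C where "C = {b \<in> S. \<not> blk b S}"
    define n where "n = m - k - 1"
    have m: "m = Suc n + k"
      using False by (simp add: n_def)
    have C: "finite C" "C \<subseteq> S"
      using psubset.hyps by (auto simp: C_def)
    have "m = card (C \<union> {b \<in> S. blk b S})"
      unfolding m_def C_def by (rule arg_cong[where f = card]) auto
    also have "\<dots> \<le> card C + card {b \<in> S. blk b S}"
      by (rule card_Un_le)
    finally have card_C: "Suc n \<le> card C"
      using psubset.prems(1)[of S] by (simp add: m)
    \<comment> \<open>The integral of \<open>p ^ k * s ^ n\<close> over \<open>{p..t}\<close>. The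
      integrand is the induction hypothesis for the other \<open>n + k\<close> agents at time
      \<open>s\<close>, since \<open>s ^ (n + k) * (p / s) ^ k = p ^ k * s ^ n\<close>.\<close>
    define r where "r = p ^ k * (t ^ Suc n - p ^ Suc n) / real (Suc n)"
    have "0 \<le> r"
      using psubset.prems by (auto simp: r_def intro!: mult_nonneg_nonneg divide_nonneg_nonneg power_mono simp del: power_Suc)
    \<comment> \<open>The first half of \<open>unblocked\<close> forces \<open>b\<close> to be last,
      so these events are disjoint for different \<open>b\<close>; the bound
      \<open>p \<le> x b\<close> separates them from \<open>early\<close>.\<close>
    define last where "last b = {x \<in> space ?M. p \<le> x b \<and> x b < t \<and> unblocked blk p (S - {b}) (x b) x}" for b
    have last_sets: "last b \<in> sets ?M" if "b \<in> C" for b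
    proof -
      have b: "b \<in> S"
        using that C by auto
      have [measurable]: "Measurable.pred ?M (\<lambda>x. unblocked blk p (S - {b}) (x b) x)"
        using psubset.hyps b by (intro unblocked_pred_measurable) auto
      show ?thesis
        unfolding last_def using b by measurable
    qed
    have last_ge: "ennreal r \<le> emeasure ?M (last b)" if "b \<in> C" for b
    proof -
      define S' where "S' = S - {b}"
      have S: "S = insert b S'" "b \<notin> S'" "finite S'" "S' \<subset> S" "card S' = n + k"
        using that C psubset.hyps m by (auto simp: S'_def m_def)
      define Q where "Q s x \<longleftrightarrow> p \<le> s \<and> s < t \<and> unblocked blk p S' s x" for s x
      have "ennreal r \<le> emeasure (arrival_space (insert b S'))
          {x \<in> space (arrival_space (insert b S')). Q (x b) x}"
      proof (rule emeasure_insert_ge[OF S(3,2), where Q = Q and p = p and t = t and g = "\<lambda>s. p ^ k * s ^ n"])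
        show "((\<lambda>s. p ^ k * s ^ n) has_integral r) {p..t}"
          unfolding r_def by (rule has_integral_power_mult) (use psubset.prems in simp)
        show "{x \<in> space (arrival_space (insert b S')). Q (x b) x} \<in> sets (arrival_space (insert b S'))"
          using last_sets[OF that] by (simp add: last_def Q_def S'_def[symmetric] S(1)[symmetric])
        show "Q y (x(b := z)) \<longleftrightarrow> Q y x" for x y z
          unfolding Q_def using S(2) by (subst unblocked_cong[of S' "x(b := z)" x]) auto
        show "0 \<le> p ^ k * s ^ n" if "s \<in> {p..t}" for s
          using that psubset.prems by auto
        show "ennreal (p ^ k * s ^ n) \<le> emeasure (arrival_space S') {x \<in> space (arrival_space S'). Q s x}"
          if s: "p \<le> s" "s < t" for s
        proof -
          have "p ^ k * s ^ n = s ^ card S' * (p / s) ^ k"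
            using s psubset.prems by (simp add: S(5) power_add power_divide)
          moreover have "ennreal (s ^ card S' * (p / s) ^ k)
              \<le> emeasure (arrival_space S') {x \<in> space (arrival_space S'). unblocked blk p S' s x}"
            using s psubset.prems S(4) by (intro psubset.IH) auto
          ultimately show ?thesis
            using s by (simp add: Q_def)
        qed
      qed (use psubset.prems in auto)
      then show ?thesis
        by (simp add: last_def Q_def S'_def[symmetric] S(1)[symmetric])
    qed
    have last_sub: "last b \<subseteq> {x \<in> space ?M. unblocked blk p S t x}" if "b \<in> C" for b
    proof -
      have S: "insert b (S - {b}) = S"
        using that C by auto
      show ?thesis
        using that unblocked_insert_last[of b "S - {b}" p _ t blk] unfolding S
        by (auto simp: last_def C_def)
    qed
    have disj: "disjoint_family_on last C"
    proof -
      have "x c < x b" if "x \<in> last b" "c \<in> C" "c \<noteq> b" for x b c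
        using that C by (auto simp: last_def unblocked_def)
      then show ?thesis
        unfolding disjoint_family_on_def by (metis disjoint_iff less_asym)
    qed
    have early_last: "early \<inter> (\<Union>b\<in>C. last b) = {}"
      using C by (fastforce simp: early_def last_def)
    \<comment> \<open>Adding \<open>p ^ m\<close>, the probability of \<open>early\<close>, cancels
      the lower limit of the integral and leaves \<open>p ^ k * t ^ (n + 1)\<close>, the claimed
      bound.\<close>
    have "real (Suc n) * r = p ^ k * (t ^ Suc n - p ^ Suc n)"
      by (simp add: r_def del: of_nat_Suc power_Suc)
    then have "t ^ m * (p / t) ^ k = p ^ m + real (Suc n) * r"
      using psubset.prems by (simp add: m power_add power_divide algebra_simps)
    also have "\<dots> \<le> p ^ m + real (card C) * r"
      using card_C \<open>0 \<le> r\<close> by (intro add_left_mono mult_right_mono) auto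
    finally have "ennreal (t ^ m * (p / t) ^ k) \<le> ennreal (p ^ m + real (card C) * r)"
      by (rule ennreal_leI)
    also have "\<dots> = ennreal (p ^ m) + (\<Sum>b\<in>C. ennreal r)"
      using psubset.prems \<open>0 \<le> r\<close> by (simp add: ennreal_plus ennreal_mult ennreal_of_nat_eq_real_of_nat)
    also have "\<dots> \<le> emeasure ?M early + (\<Sum>b\<in>C. emeasure ?M (last b))"
      unfolding early_eq by (intro add_left_mono sum_mono last_ge)
    also have "(\<Sum>b\<in>C. emeasure ?M (last b)) = emeasure ?M (\<Union>b\<in>C. last b)"
      using last_sets disj C by (intro sum_emeasure) auto
    also have "emeasure ?M early + \<dots> = emeasure ?M (early \<union> (\<Union>b\<in>C. last b))"
      using last_sets early_sets early_last C by (intro plus_emeasure) auto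
    also have "\<dots> \<le> emeasure ?M {x \<in> space ?M. unblocked blk p S t x}"
      using early_sub last_sub by (intro emeasure_mono[OF _ sets]) blast
    finally show ?thesis
      by (simp add: m_def)
  qed
qed

text \<open>The two conditions read disjoint sets of coordinates, so the indicator factors along
  \<open>merge\<close>.\<close>

lemma emeasure_unblocked_late:
  assumes "finite S" "finite J" "S \<inter> J = {}" "0 \<le> t" "t \<le> 1"
  shows "emeasure (arrival_space (S \<union> J))
      {x \<in> space (arrival_space (S \<union> J)). unblocked blk p S t x \<and> (\<forall>c\<in>J. t < x c)}
    = emeasure (arrival_space S) {x \<in> space (arrival_space S). unblocked blk p S t x}
      * ennreal ((1 - t) ^ card J)"
proof -
  let ?E = "{x \<in> space (arrival_space (S \<union> J)). unblocked blk p S t x \<and> (\<forall>c\<in>J. t < x c)}"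
  let ?ES = "{x \<in> space (arrival_space S). unblocked blk p S t x}"
  let ?EJ = "{x \<in> space (arrival_space J). \<forall>c\<in>J. t < x c}"
  have ES: "?ES \<in> sets (arrival_space S)"
    by (rule unblocked_sets[OF assms(1)])
  have EJ: "?EJ \<in> sets (arrival_space J)"
    using assms(2) by measurable
  have "Measurable.pred (arrival_space (S \<union> J)) (\<lambda>x. unblocked blk p S t x)"
    using assms(1) by (intro unblocked_pred_measurable) auto
  moreover have "Measurable.pred (arrival_space (S \<union> J)) (\<lambda>x. \<forall>c\<in>J. t < x c)"
    using assms(2) by measurable
  ultimately have E: "?E \<in> sets (arrival_space (S \<union> J))"
    by measurable
  have "indicator ?E (merge S J (x, y)) = (indicator ?ES x * indicator ?EJ y :: ennreal)"
    if xy: "x \<in> space (arrival_space S)" "y \<in> space (arrival_space J)" for x y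
  proof -
    have "merge S J (x, y) \<in> space (arrival_space (S \<union> J))"
      using measurable_space[OF measurable_merge, of "(x, y)" S "\<lambda>_. uniform01" J] xy
      by (simp add: space_pair_measure)
    moreover have "unblocked blk p S t (merge S J (x, y)) \<longleftrightarrow> unblocked blk p S t x"
      using assms(3) by (intro unblocked_cong) (auto simp: merge_def)
    moreover have "(\<forall>c\<in>J. t < merge S J (x, y) c) \<longleftrightarrow> (\<forall>c\<in>J. t < y c)"
      using assms(3) by (auto simp: merge_def)
    ultimately show ?thesis
      using xy by (auto simp: indicator_def)
  qed
  then have "emeasure (arrival_space (S \<union> J)) ?E
      = (\<integral>\<^sup>+x. (\<integral>\<^sup>+y. indicator ?ES x * indicator ?EJ y \<partial>arrival_space J) \<partial>arrival_space S)"
    unfolding nn_integral_indicator[OF E, symmetric]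
    by (subst arrivals.product_nn_integral_fold[OF assms(3,1,2) borel_measurable_indicator[OF E]])
      (intro nn_integral_cong, simp)
  also have "\<dots> = emeasure (arrival_space S) ?ES * emeasure (arrival_space J) ?EJ"
    using ES EJ by (simp add: nn_integral_cmult nn_integral_multc)
  also have "emeasure (arrival_space J) ?EJ = ennreal ((1 - t) ^ card J)"
    using assms by (intro emeasure_all_greaterThan)
  finally show ?thesis .
qed

text \<open>
  The strict inequalities, also inside \<open>unblocked\<close>, exclude ties with \<open>a\<close>, so that the order chosen
  for simultaneous arrivals plays no role.
\<close>

definition last_unblocked ::
  "('v \<Rightarrow> 'v set \<Rightarrow> bool) \<Rightarrow> real \<Rightarrow> 'v set \<Rightarrow> 'v set \<Rightarrow> 'v \<Rightarrow> ('v \<Rightarrow> real) \<Rightarrow> bool" where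
  "last_unblocked blk p A B a x \<longleftrightarrow> p \<le> x a \<and> x a < 1 \<and>
     unblocked blk p (B - {a}) (x a) x \<and> (\<forall>c\<in>A - B. x a < x c)"

lemma last_unblocked_cong:
  assumes "a \<in> B" "B \<subseteq> A" "\<And>c. c \<in> A \<Longrightarrow> x c = y c"
  shows "last_unblocked blk p A B a x \<longleftrightarrow> last_unblocked blk p A B a y"
proof -
  have "x a = y a"
    using assms by auto
  moreover have "unblocked blk p (B - {a}) t x \<longleftrightarrow> unblocked blk p (B - {a}) t y" for t
    using assms by (intro unblocked_cong) auto
  ultimately show ?thesis
    using assms by (auto simp: last_unblocked_def)
qed

lemma last_unblocked_pred_measurable:
  assumes "finite A" "a \<in> B" "B \<subseteq> A"
    and X: "\<And>b. b \<in> A \<Longrightarrow> (\<lambda>x. X x b) \<in> borel_measurable N"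
  shows "Measurable.pred N (\<lambda>x. last_unblocked blk p A B a (X x))"
proof -
  have a [measurable]: "(\<lambda>x. X x a) \<in> borel_measurable N"
    using assms by auto
  have "finite B"
    using assms(1,3) by (rule rev_finite_subset)
  then have [measurable]: "Measurable.pred N (\<lambda>x. unblocked blk p (B - {a}) (X x a) (X x))"
    using assms by (intro unblocked_pred_measurable) auto
  have "Measurable.pred N (\<lambda>x. X x a < X x c)" if "c \<in> A" for c
    using X[OF that] by measurable
  then have [measurable]: "Measurable.pred N (\<lambda>x. \<forall>c\<in>A - B. X x a < X x c)"
    using assms(1) by (intro pred_intros_finite) auto
  show ?thesis
    unfolding last_unblocked_def by measurable
qed

text \<open>Given that \<open>a\<close> arrives at \<open>s\<close>, the other
  \<open>card B - 1\<close> agents of \<open>B\<close> must come earlier without blocking and those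
  outside \<open>B\<close> later. The two estimates multiply to the integrand.\<close>

lemma emeasure_last_unblocked_ge:
  assumes A: "finite A" "a \<in> B" "B \<subseteq> A"
    and blk: "\<And>C. C \<subseteq> A \<Longrightarrow> card {b \<in> C. blk b C} \<le> k"
    and p: "0 < p" "p < 1"
  shows "ennreal (integral {p..1} (\<lambda>s. s ^ (card B - 1) * (1 - s) ^ card (A - B) * (p / s) ^ k))
    \<le> emeasure (arrival_space A) {x \<in> space (arrival_space A). last_unblocked blk p A B a x}"
proof -
  define I where "I = A - {a}"
  define g where "g s = s ^ (card B - 1) * (1 - s) ^ card (A - B) * (p / s) ^ k" for s
  define Q where "Q s x \<longleftrightarrow> p \<le> s \<and> s < 1 \<and> unblocked blk p (B - {a}) s x \<and> (\<forall>c\<in>A - B. s < x c)" for s x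
  have I: "finite I" "a \<notin> I" "insert a I = A" "I = (B - {a}) \<union> (A - B)"
    using A by (auto simp: I_def)
  have "finite B"
    using A rev_finite_subset by blast
  have Q: "last_unblocked blk p A B a x \<longleftrightarrow> Q (x a) x" for x
    by (simp add: last_unblocked_def Q_def)
  have "ennreal (integral {p..1} g) \<le> emeasure (arrival_space (insert a I))
      {x \<in> space (arrival_space (insert a I)). Q (x a) x}"
  proof (rule emeasure_insert_ge[OF I(1,2), where Q = Q and p = p and t = 1 and g = g])
    \<comment> \<open>As \<open>p\<close> is positive, the integrand has no pole in the interval, so
      \<open>integral\<close> is a genuine value and not the default 0.\<close>
    have "continuous_on {p..1} g"
      using p unfolding g_def by (intro continuous_intros) auto
    then show "(g has_integral integral {p..1} g) {p..1}"
      by (intro integrable_integral integrable_continuous_real)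
    show "{x \<in> space (arrival_space (insert a I)). Q (x a) x} \<in> sets (arrival_space (insert a I))"
      unfolding Q[symmetric] I(3) using A
      by (intro predE last_unblocked_pred_measurable) auto
    show "Q y (x(a := z)) \<longleftrightarrow> Q y x" for x y z
    proof -
      have "unblocked blk p (B - {a}) y (x(a := z)) \<longleftrightarrow> unblocked blk p (B - {a}) y x"
        by (rule unblocked_cong) auto
      then show ?thesis
        using A(2) by (auto simp: Q_def)
    qed
    show "0 \<le> g s" if "s \<in> {p..1}" for s
      using that p by (auto simp: g_def)
    show "ennreal (g s) \<le> emeasure (arrival_space I) {x \<in> space (arrival_space I). Q s x}"
      if s: "p \<le> s" "s < 1" for s
    proof -
      have "g s = s ^ card (B - {a}) * (p / s) ^ k * (1 - s) ^ card (A - B)"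
        using A(2) by (simp add: g_def card_Diff_singleton)
      moreover have "0 \<le> (1 - s) ^ card (A - B)"
        using s by simp
      ultimately have "ennreal (g s) = ennreal (s ^ card (B - {a}) * (p / s) ^ k) * ennreal ((1 - s) ^ card (A - B))"
        by (simp only: ennreal_mult'')
      also have "\<dots> \<le> emeasure (arrival_space (B - {a}))
          {x \<in> space (arrival_space (B - {a})). unblocked blk p (B - {a}) s x} * ennreal ((1 - s) ^ card (A - B))"
        using s p A \<open>finite B\<close> by (intro mult_right_mono emeasure_unblocked_ge blk) auto
      also have "\<dots> = emeasure (arrival_space I)
          {x \<in> space (arrival_space I). unblocked blk p (B - {a}) s x \<and> (\<forall>c\<in>A - B. s < x c)}"
        unfolding I(4) using s p A \<open>finite B\<close> by (intro emeasure_unblocked_late[symmetric]) auto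
      finally show ?thesis
        using s by (simp add: Q_def)
    qed
  qed (use p in auto)
  then show ?thesis
    by (simp add: Q I(3) g_def[abs_def])
qed

subsection \<open>The ratio and the optimal threshold\<close>

lemma basic_ratio_1:
  assumes "0 < p" "p < 1"
  shows "basic_ratio 1 p = - p * ln p"
proof -
  have "((\<lambda>t. p / t) has_integral p * ln 1 - p * ln p) {p..1}"
    using assms by (intro fundamental_theorem_of_calculus)
      (auto intro!: derivative_eq_intros simp flip: has_real_derivative_iff_has_vector_derivative)
  then show ?thesis
    by (simp add: basic_ratio_def integral_unique)
qed

lemma basic_ratio_ge_2:
  assumes "0 < p" "p < 1" "2 \<le> k"
  shows "basic_ratio k p = (p - p ^ k) / (real k - 1)"
proof -
  obtain m where k: "k = Suc (Suc m)"
    using assms(3) by (metis Suc_le_D numeral_2_eq_2 Suc_le_mono)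
  \<comment> \<open>An antiderivative of \<open>(p / t) ^ k\<close>; with \<open>k = m + 2\<close>,
    natural powers of \<open>inverse t\<close> express the negative exponent
    \<open>1 - k\<close>.\<close>
  define F where "F t = - (p ^ k) * inverse t ^ Suc m / real (Suc m)" for t
  have "((\<lambda>t. (p / t) ^ k) has_integral F 1 - F p) {p..1}"
  proof (rule fundamental_theorem_of_calculus)
    fix t assume t: "t \<in> {p..1}"
    then have "(F has_real_derivative
        - (p ^ k) * (real (Suc m) * inverse t ^ m * - (inverse t * inverse t)) / real (Suc m)) (at t within {p..1})"
      unfolding F_def using assms(1)
      by (auto intro!: derivative_eq_intros simp del: of_nat_Suc power_Suc)
    also have "- (p ^ k) * (real (Suc m) * inverse t ^ m * - (inverse t * inverse t)) / real (Suc m)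
        = (p / t) ^ k"
      by (simp add: k divide_inverse power_mult_distrib del: of_nat_Suc)
    finally show "(F has_vector_derivative (p / t) ^ k) (at t within {p..1})"
      by (simp add: has_real_derivative_iff_has_vector_derivative)
  qed (use assms in simp)
  moreover have "F 1 - F p = (p - p ^ k) / (real k - 1)"
  proof -
    have "p ^ k * inverse p ^ Suc m = p"
      using assms(1) by (simp add: k power_inverse field_simps)
    moreover have "real k - 1 = real (Suc m)"
      by (simp add: k)
    ultimately show ?thesis
      by (simp add: F_def diff_divide_distrib del: power_Suc of_nat_Suc)
  qed
  ultimately show ?thesis
    by (simp add: basic_ratio_def integral_unique)
qed

text \<open>The derivative of \<open>p - p ^ k\<close> vanishes where
  \<open>p ^ (k - 1) = 1 / k\<close>, which gives this \<open>p\<close>. Then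
  \<open>p ^ k = p / k\<close>, the factor \<open>k - 1\<close> cancels, and the ratio is
  \<open>p / k\<close>.\<close>

lemma basic_ratio_optimum_ge_2:
  assumes "2 \<le> k"
  defines "p \<equiv> real k powr (- (1 / (real k - 1)))"
  shows "0 < p" "p < 1" "basic_ratio k p = real k powr (- (real k / (real k - 1)))"
proof -
  show p0: "0 < p"
    using assms by simp
  have "p < real k powr 0"
    unfolding p_def using assms(1) by (intro powr_less_mono) auto
  then show p1: "p < 1"
    using assms by simp
  have "p ^ k = p powr real k"
    using p0 by (simp add: powr_realpow)
  also have "\<dots> = real k powr (- (1 / (real k - 1)) - 1)"
    using assms(1) by (simp add: p_def powr_powr field_simps)
  also have "\<dots> = p / real k"
    using assms(1) by (simp add: p_def powr_diff)
  finally have "basic_ratio k p = (p - p / real k) / (real k - 1)"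
    using basic_ratio_ge_2[OF p0 p1 assms(1)] by simp
  also have "\<dots> = p / real k"
    using assms(1) by (simp add: field_simps)
  also have "\<dots> = real k powr (- (1 / (real k - 1)) - 1)"
    using assms(1) by (simp add: p_def powr_diff)
  also have "- (1 / (real k - 1)) - 1 = - (real k / (real k - 1))"
    using assms(1) by (simp add: field_simps)
  finally show "basic_ratio k p = real k powr (- (real k / (real k - 1)))" .
qed

subsection \<open>Expected weight\<close>

text \<open>For \<open>s\<close> in the unit interval, the summands are the probabilities of a
  random set that contains \<open>a\<close> and each other agent independently with probability
  \<open>s\<close>. Algebraically, they expand a product of factors
  \<open>s + (1 - s)\<close>.\<close>

lemma sum_subsets_containing:
  fixes s :: real
  assumes "finite A" "a \<in> A"
  shows "(\<Sum>B | B \<in> Pow A \<and> a \<in> B. s ^ (card B - 1) * (1 - s) ^ card (A - B)) = 1"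
proof -
  let ?A = "A - {a}"
  have "(\<Sum>B | B \<in> Pow A \<and> a \<in> B. s ^ (card B - 1) * (1 - s) ^ card (A - B))
      = (\<Sum>B\<in>Pow ?A. s ^ card B * (1 - s) ^ card (?A - B))"
    by (rule sum.reindex_bij_witness[where i = "insert a" and j = "\<lambda>B. B - {a}"])
      (use assms in \<open>auto simp: insert_absorb Diff_insert2[symmetric] finite_subset
        intro!: arg_cong[where f = card]\<close>)
  also have "\<dots> = (\<Prod>b\<in>?A. s + (1 - s))"
    using assms by (subst prod_add) auto
  also have "\<dots> = 1"
    by simp
  finally show ?thesis .
qed

context assignment_instance
begin

lemma finite_subset_edges: "F \<subseteq> edges G \<Longrightarrow> finite F"
  using finite_edges finite_subset by blast

lemma total_weight_basic_assignment_measurable: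
  assumes T: "\<And>a. a \<in> agents G \<Longrightarrow> T a \<in> borel_measurable M"
  shows "(\<lambda>\<omega>. total_weight G (basic_assignment G OPT p (\<lambda>a. T a \<omega>))) \<in> borel_measurable M"
proof -
  define W where "W \<omega> = total_weight G (basic_assignment G OPT p (\<lambda>a. T a \<omega>))" for \<omega>
  \<comment> \<open>Everything about the times that the run consults, as an element of a finite
    set.\<close>
  define h where "h \<omega> = ({(a, b) \<in> agents G \<times> agents G. T a \<omega> \<le> T b \<omega>}, {a \<in> agents G. T a \<omega> \<in> {p..1}})" for \<omega>
  define D where "D = Pow (agents G \<times> agents G) \<times> Pow (agents G)"
  have "h -` {d} \<inter> space M \<in> sets M" if "d \<in> D" for d
  proof -
    obtain R S where d: "d = (R, S)" "R \<subseteq> agents G \<times> agents G" "S \<subseteq> agents G"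
      using \<open>d \<in> D\<close> by (auto simp: D_def)
    have eq: "h -` {d} \<inter> space M = {\<omega> \<in> space M. (\<forall>a\<in>agents G. \<forall>b\<in>agents G. T a \<omega> \<le> T b \<omega> \<longleftrightarrow> (a, b) \<in> R)
        \<and> (\<forall>a\<in>agents G. T a \<omega> \<in> {p..1} \<longleftrightarrow> a \<in> S)}"
    proof -
      have "{(a, b) \<in> agents G \<times> agents G. P a b} = R \<longleftrightarrow> (\<forall>a\<in>agents G. \<forall>b\<in>agents G. P a b \<longleftrightarrow> (a, b) \<in> R)" for P
        using d(2) by blast
      moreover have "{a \<in> agents G. P a} = S \<longleftrightarrow> (\<forall>a\<in>agents G. P a \<longleftrightarrow> a \<in> S)" for P
        using d(3) by blast
      ultimately have "h \<omega> = d \<longleftrightarrow> (\<forall>a\<in>agents G. \<forall>b\<in>agents G. T a \<omega> \<le> T b \<omega> \<longleftrightarrow> (a, b) \<in> R)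
          \<and> (\<forall>a\<in>agents G. T a \<omega> \<in> {p..1} \<longleftrightarrow> a \<in> S)" for \<omega>
        by (simp only: h_def d(1) prod.inject)
      then show ?thesis
        by blast
    qed
    have "Measurable.pred M (\<lambda>\<omega>. T a \<omega> \<le> T b \<omega> \<longleftrightarrow> (a, b) \<in> R)" if "a \<in> agents G" "b \<in> agents G" for a b
      using T[OF that(1)] T[OF that(2)] by measurable
    then have [measurable]: "Measurable.pred M (\<lambda>\<omega>. \<forall>a\<in>agents G. \<forall>b\<in>agents G. T a \<omega> \<le> T b \<omega> \<longleftrightarrow> (a, b) \<in> R)"
      using finite_agents by (intro pred_intros_finite) auto
    have "Measurable.pred M (\<lambda>\<omega>. T a \<omega> \<in> {p..1} \<longleftrightarrow> a \<in> S)" if "a \<in> agents G" for a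
      using T[OF that] by measurable
    then have [measurable]: "Measurable.pred M (\<lambda>\<omega>. \<forall>a\<in>agents G. T a \<omega> \<in> {p..1} \<longleftrightarrow> a \<in> S)"
      using finite_agents by (intro pred_intros_finite) auto
    show ?thesis
      unfolding eq by measurable
  qed
  moreover have "finite D"
    using finite_agents by (simp add: D_def)
  ultimately have h: "h \<in> M \<rightarrow>\<^sub>M count_space D"
    by (subst measurable_count_space_eq2) (auto simp: D_def h_def)
  have W_eq: "W \<omega> = W \<omega>'" if "h \<omega> = h \<omega>'" for \<omega> \<omega>'
  proof -
    have "T a \<omega> \<le> T b \<omega> \<longleftrightarrow> T a \<omega>' \<le> T b \<omega>'" if "a \<in> agents G" "b \<in> agents G" for a b
      using \<open>h \<omega> = h \<omega>'\<close> that unfolding h_def by blast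
    moreover have "T a \<omega> \<in> {p..1} \<longleftrightarrow> T a \<omega>' \<in> {p..1}" if "a \<in> agents G" for a
      using \<open>h \<omega> = h \<omega>'\<close> that unfolding h_def by blast
    ultimately show ?thesis
      unfolding W_def by (intro arg_cong[where f = "total_weight G"] basic_assignment_cong)
  qed
  \<comment> \<open>Representing each pattern by a chosen outcome exhibits \<open>W\<close> as a
    function of \<open>h\<close>.\<close>
  have "W \<omega> = W (SOME \<omega>'. h \<omega>' = h \<omega>)" for \<omega>
    by (rule W_eq[symmetric], rule someI) simp
  then have "W = (\<lambda>d. W (SOME \<omega>'. h \<omega>' = d)) \<circ> h"
    by (simp add: fun_eq_iff)
  also have "\<dots> \<in> borel_measurable M"
    by (rule measurable_comp[OF h]) simp
  finally show ?thesis
    by (simp add: W_def[abs_def])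
qed

text \<open>The strict inequalities make \<open>B\<close> exactly the set present when
  \<open>a\<close> arrives. Hence \<open>B\<close> can be recovered from \<open>t\<close>, and the
  sets seen by \<open>unblocked\<close> are those that the algorithm sees.\<close>

lemma last_unblocked_selected:
  assumes B: "B \<subseteq> agents G" "a \<in> B" and e: "e \<in> OPT B" "agent_of G e = a"
    and last: "last_unblocked (blocks e) p (agents G) B a t"
  shows "arrived G t (t a) = B" "e \<in> basic_assignment G OPT p t"
proof -
  have before: "t b < t a" if "b \<in> B - {a}" for b
    using last that by (auto simp: last_unblocked_def unblocked_def)
  have after: "t a < t c" if "c \<in> agents G - B" for c
    using last that by (auto simp: last_unblocked_def)
  show arrived: "arrived G t (t a) = B"
  proof (rule set_eqI)
    fix c
    show "c \<in> arrived G t (t a) \<longleftrightarrow> c \<in> B"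
      using before[of c] after[of c] B by (cases "c = a"; cases "c \<in> B") (auto simp: arrived_def)
  qed
  show "e \<in> basic_assignment G OPT p t"
  proof (rule selected_if_unblocked)
    show "e \<in> OPT (arrived G t (t a))" "agent_of G e = a" "a \<in> agents G" "p \<le> t a" "t a \<le> 1"
      using arrived e B last by (auto simp: last_unblocked_def)
    fix b
    assume b: "b \<in> arrived G t (t a) - {a}" "p \<le> t b"
    then have "b \<in> B - {a}"
      using arrived by simp
    moreover have "arrived G t (t b) = {c \<in> B - {a}. t c \<le> t b}"
    proof (rule set_eqI)
      fix c
      show "c \<in> arrived G t (t b) \<longleftrightarrow> c \<in> {c \<in> B - {a}. t c \<le> t b}"
        using before[OF \<open>b \<in> B - {a}\<close>] after[of c] B by (cases "c = a"; cases "c \<in> B") (auto simp: arrived_def)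
    qed
    ultimately show "\<not> blocks e b (arrived G t (t b))"
      using last b(2) by (auto simp: last_unblocked_def unblocked_def)
  qed
qed

text \<open>
  A random set of agents that contains each agent with probability \<open>s\<close> contains the agent of a
  given edge of \<open>OPT (agents G)\<close> with probability \<open>s\<close>; the weights below carry the factor \<open>1/s\<close>.
\<close>

lemma sum_OPT_ge:
  assumes "0 \<le> s" "s \<le> 1"
  defines "q \<equiv> \<lambda>B. s ^ (card B - 1) * (1 - s) ^ card (agents G - B)"
  shows "total_weight G (OPT (agents G))
    \<le> (\<Sum>e\<in>edges G. weight G e * (\<Sum>B | B \<in> Pow (agents G) \<and> e \<in> OPT B. q B))"
proof -
  let ?O = "OPT (agents G)"
  have O: "?O \<subseteq> edges G" "finite ?O"
    using OPT_subset[of "agents G"] finite_subset_edges by auto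
  \<comment> \<open>Each edge of \<open>?O\<close> gets the coefficient 1, written as a sum over the
    sets that contain its agent.\<close>
  have "total_weight G ?O
      = (\<Sum>e\<in>?O. weight G e * (\<Sum>B | B \<in> Pow (agents G) \<and> agent_of G e \<in> B. q B))"
    unfolding total_weight_def q_def
    using O(1) by (intro sum.cong refl)
      (subst sum_subsets_containing[OF finite_agents], auto simp: agent_of_in_agents)
  \<comment> \<open>The sum now includes \<open>B = {}\<close>, where \<open>card B - 1\<close>
    truncates to 0; its coefficient multiplies the weight of an empty set.\<close>
  also have "\<dots> = (\<Sum>B\<in>Pow (agents G). q B * total_weight G {e \<in> ?O. agent_of G e \<in> B})"
    unfolding total_weight_def sum_distrib_left
    by (subst sum.swap_restrict) (auto simp: O finite_agents mult.commute)
  \<comment> \<open>The edges of the global optimum with agent in \<open>B\<close> compete against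
    \<open>OPT B\<close>.\<close>
  also have "\<dots> \<le> (\<Sum>B\<in>Pow (agents G). q B * total_weight G (OPT B))"
  proof (rule sum_mono)
    fix B assume "B \<in> Pow (agents G)"
    then have "total_weight G {e \<in> ?O. agent_of G e \<in> B} \<le> total_weight G (OPT B)"
      by (intro total_weight_le_OPT feasible_subset[OF feasible_OPT[of "agents G"]]) auto
    then show "q B * total_weight G {e \<in> ?O. agent_of G e \<in> B} \<le> q B * total_weight G (OPT B)"
      using assms(1,2) by (intro mult_left_mono) (auto simp: q_def)
  qed
  also have "\<dots> = (\<Sum>B\<in>Pow (agents G). \<Sum>e | e \<in> edges G \<and> e \<in> OPT B. weight G e * q B)"
  proof (rule sum.cong)
    fix B assume "B \<in> Pow (agents G)"
    then have "{e. e \<in> edges G \<and> e \<in> OPT B} = OPT B"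
      using OPT_subset by auto
    then show "q B * total_weight G (OPT B) = (\<Sum>e | e \<in> edges G \<and> e \<in> OPT B. weight G e * q B)"
      by (simp add: total_weight_def sum_distrib_left mult.commute)
  qed simp
  also have "\<dots> = (\<Sum>e\<in>edges G. weight G e * (\<Sum>B | B \<in> Pow (agents G) \<and> e \<in> OPT B. q B))"
    unfolding sum_distrib_left
    by (subst sum.swap_restrict) (auto simp: finite_agents finite_edges)
  finally show ?thesis .
qed

text \<open>Independence and uniformity identify the joint law of the arrival times with the product
  measure, so the estimate on \<open>arrival_space\<close> transfers to \<open>M\<close>.\<close>

lemma measure_last_unblocked_ge:
  assumes unif: "uniform_arrivals M (agents G) T"
    and e: "e \<in> edges G" and B: "B \<subseteq> agents G" "a \<in> B" and p: "0 < p" "p < 1"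
  shows "integral {p..1} (\<lambda>s. s ^ (card B - 1) * (1 - s) ^ card (agents G - B) * (p / s) ^ k)
    \<le> measure M {\<omega> \<in> space M. last_unblocked (blocks e) p (agents G) B a (\<lambda>a. T a \<omega>)}"
proof -
  let ?A = "agents G"
  let ?L = "last_unblocked (blocks e) p ?A B a"
  let ?E = "{x \<in> space (arrival_space ?A). ?L x}"
  interpret prob_space M
    using unif by (simp add: uniform_arrivals_def)
  have indep: "indep_vars (\<lambda>_. borel) T ?A"
    and unif: "\<And>a. a \<in> ?A \<Longrightarrow> distr M borel (T a) = uniform01"
    using unif by (auto simp: uniform_arrivals_def)
  have T: "T a \<in> borel_measurable M" if "a \<in> ?A" for a
    using indep that by (auto simp: indep_vars_def)
  have sets_eq: "sets (PiM ?A (\<lambda>_. borel)) = sets (arrival_space ?A)"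
    by (rule sets_PiM_cong) auto
  have rst: "(\<lambda>\<omega>. \<lambda>a\<in>?A. T a \<omega>) \<in> M \<rightarrow>\<^sub>M PiM ?A (\<lambda>_. borel)"
    using T by (intro measurable_restrict) auto
  have "?A \<noteq> {}"
    using B by auto
  from indep_vars_iff_distr_eq_PiM'[OF this, where X = T and M' = "\<lambda>_. borel"]
  have "distr M (PiM ?A (\<lambda>_. borel)) (\<lambda>\<omega>. \<lambda>a\<in>?A. T a \<omega>) = PiM ?A (\<lambda>a. distr M borel (T a))"
    using T indep by simp
  also have "\<dots> = arrival_space ?A"
    by (rule PiM_cong) (auto simp: unif)
  finally have distr: "distr M (PiM ?A (\<lambda>_. borel)) (\<lambda>\<omega>. \<lambda>a\<in>?A. T a \<omega>) = arrival_space ?A" .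
  have E: "?E \<in> sets (arrival_space ?A)"
    using B by (intro predE last_unblocked_pred_measurable[OF finite_agents]) auto
  have "ennreal (integral {p..1} (\<lambda>s. s ^ (card B - 1) * (1 - s) ^ card (?A - B) * (p / s) ^ k))
      \<le> emeasure (arrival_space ?A) ?E"
    using B card_blocks_le[OF _ e] p
    by (intro emeasure_last_unblocked_ge[OF finite_agents]) auto
  also have "\<dots> = emeasure M ((\<lambda>\<omega>. \<lambda>a\<in>?A. T a \<omega>) -` ?E \<inter> space M)"
    unfolding distr[symmetric] by (rule emeasure_distr[OF rst]) (use E in \<open>simp add: sets_eq distr\<close>)
  also have "(\<lambda>\<omega>. \<lambda>a\<in>?A. T a \<omega>) -` ?E \<inter> space M = {\<omega> \<in> space M. ?L (\<lambda>a. T a \<omega>)}"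
  proof -
    have "?L (\<lambda>a\<in>?A. T a \<omega>) \<longleftrightarrow> ?L (\<lambda>a. T a \<omega>)" for \<omega>
      using B by (intro last_unblocked_cong) auto
    then show ?thesis
      by (auto simp: space_PiM)
  qed
  finally show ?thesis
    by (simp add: emeasure_eq_measure)
qed

text \<open>The bound \<open>sum_OPT_ge\<close>, multiplied by \<open>(p / s) ^ k\<close> and
  integrated over \<open>s\<close>, turns into a weighted sum of lower bounds for the probabilities
  of the events \<open>L e B\<close>. For fixed \<open>e\<close> these are disjoint in
  \<open>B\<close>, and each implies that \<open>e\<close> is selected.\<close>

lemma expected_weight_ge:
  assumes unif: "uniform_arrivals M (agents G) T" and p: "0 < p" "p < 1"
  shows "basic_ratio k p * total_weight G (OPT (agents G))
    \<le> (\<integral>\<omega>. total_weight G (basic_assignment G OPT p (\<lambda>a. T a \<omega>)) \<partial>M)"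
proof -
  let ?A = "agents G"
  interpret prob_space M
    using unif by (simp add: uniform_arrivals_def)
  have T: "T a \<in> borel_measurable M" if "a \<in> ?A" for a
    using unif that by (auto simp: uniform_arrivals_def indep_vars_def)
  define ALG where "ALG \<omega> = basic_assignment G OPT p (\<lambda>a. T a \<omega>)" for \<omega>
  define \<B> where "\<B> e = {B \<in> Pow ?A. e \<in> OPT B}" for e
  define L where "L e B = {\<omega> \<in> space M. last_unblocked (blocks e) p ?A B (agent_of G e) (\<lambda>a. T a \<omega>)}" for e B
  define q where "q B s = s ^ (card B - 1) * (1 - s) ^ card (?A - B)" for B and s :: real
  have \<B>: "finite (\<B> e)" for e
    using finite_agents by (simp add: \<B>_def)
  have \<B>_agent: "agent_of G e \<in> B" "B \<subseteq> ?A" if "B \<in> \<B> e" for e B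
    using that agent_of_OPT by (auto simp: \<B>_def)
  have L_sets: "L e B \<in> events" if "B \<in> \<B> e" for e B
    unfolding L_def using \<B>_agent[OF that] T
    by (intro predE last_unblocked_pred_measurable[OF finite_agents]) auto
  have ALG: "ALG \<omega> \<subseteq> edges G" for \<omega>
    using feasible_basic_assignment[of p "\<lambda>a. T a \<omega>"] by (auto simp: ALG_def feasible_def)
  have weight_eq: "total_weight G (ALG \<omega>) = (\<Sum>e\<in>edges G. weight G e * indicator (ALG \<omega>) e)" for \<omega>
    using ALG[of \<omega>] finite_edges
    by (simp add: total_weight_def indicator_def sum.If_cases Int_absorb1 if_distrib cong: if_cong)
  have q_cont: "continuous_on {p..1} (\<lambda>s. q B s * (p / s) ^ k)" for B
    using p unfolding q_def by (intro continuous_intros) auto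
  have q_int: "(\<lambda>s. q B s * (p / s) ^ k) integrable_on {p..1}" for B
    by (rule integrable_continuous_real[OF q_cont])
  have selected: "(\<Sum>B\<in>\<B> e. indicator (L e B) \<omega>) \<le> (indicator (ALG \<omega>) e :: real)" for e \<omega>
  proof (cases "\<exists>B\<in>\<B> e. \<omega> \<in> L e B")
    case True
    then obtain B where B: "B \<in> \<B> e" "\<omega> \<in> L e B"
      by blast
    have uniq: "C = arrived G (\<lambda>a. T a \<omega>) (T (agent_of G e) \<omega>)" "e \<in> ALG \<omega>"
      if "C \<in> \<B> e" "\<omega> \<in> L e C" for C
      using last_unblocked_selected[of C "agent_of G e" e p "\<lambda>a. T a \<omega>"] that \<B>_agent[OF that(1)]
      by (auto simp: L_def \<B>_def ALG_def)
    have "(\<Sum>C\<in>\<B> e. indicator (L e C) \<omega>) = (\<Sum>C\<in>\<B> e. if C = B then 1 else 0 :: real)"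
      using uniq(1) B by (intro sum.cong) (auto simp: indicator_def)
    also have "\<dots> \<le> 1"
      using \<B> B by simp
    finally show ?thesis
      using uniq(2) B by simp
  next
    case False
    then have "(\<Sum>B\<in>\<B> e. indicator (L e B) \<omega>) = (0 :: real)"
      by (intro sum.neutral) auto
    then show ?thesis
      by simp
  qed
  have "basic_ratio k p * total_weight G (OPT ?A)
      = integral {p..1} (\<lambda>s. (p / s) ^ k * total_weight G (OPT ?A))"
    by (simp add: basic_ratio_def)
  also have "\<dots> \<le> integral {p..1} (\<lambda>s. \<Sum>e\<in>edges G. weight G e * (\<Sum>B\<in>\<B> e. q B s * (p / s) ^ k))"
  proof (rule integral_le)
    show "(\<lambda>s. (p / s) ^ k * total_weight G (OPT ?A)) integrable_on {p..1}"
      using p by (intro integrable_continuous_real continuous_intros) auto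
    show "(\<lambda>s. \<Sum>e\<in>edges G. weight G e * (\<Sum>B\<in>\<B> e. q B s * (p / s) ^ k)) integrable_on {p..1}"
      by (intro integrable_continuous_real continuous_intros q_cont)
    fix s assume s: "s \<in> {p..1}"
    then have "(p / s) ^ k * total_weight G (OPT ?A)
        \<le> (p / s) ^ k * (\<Sum>e\<in>edges G. weight G e * (\<Sum>B | B \<in> Pow ?A \<and> e \<in> OPT B. q B s))"
      unfolding q_def using p by (intro mult_left_mono sum_OPT_ge) auto
    then show "(p / s) ^ k * total_weight G (OPT ?A)
        \<le> (\<Sum>e\<in>edges G. weight G e * (\<Sum>B\<in>\<B> e. q B s * (p / s) ^ k))"
      by (simp add: \<B>_def sum_distrib_left mult_ac)
  qed
  also have "\<dots> = (\<Sum>e\<in>edges G. weight G e * (\<Sum>B\<in>\<B> e. integral {p..1} (\<lambda>s. q B s * (p / s) ^ k)))"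
  proof -
    have inner: "integral {p..1} (\<lambda>s. weight G e * (\<Sum>B\<in>\<B> e. q B s * (p / s) ^ k))
        = weight G e * (\<Sum>B\<in>\<B> e. integral {p..1} (\<lambda>s. q B s * (p / s) ^ k))" for e
      by (simp add: Henstock_Kurzweil_Integration.integral_sum[OF \<B> q_int])
    show ?thesis
      unfolding inner[symmetric]
      by (intro Henstock_Kurzweil_Integration.integral_sum finite_edges
          integrable_continuous_real continuous_intros q_cont)
  qed
  also have "\<dots> \<le> (\<Sum>e\<in>edges G. weight G e * (\<Sum>B\<in>\<B> e. prob (L e B)))"
    unfolding q_def L_def using \<B>_agent p weight_nonneg
    by (intro sum_mono mult_left_mono measure_last_unblocked_ge[OF unif])
  also have "\<dots> = (\<integral>\<omega>. (\<Sum>e\<in>edges G. weight G e * (\<Sum>B\<in>\<B> e. indicator (L e B) \<omega>)) \<partial>M)"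
    using L_sets by (simp add: integrable_sum integrable_mult_right emeasure_eq_measure)
  also have "\<dots> \<le> (\<integral>\<omega>. total_weight G (ALG \<omega>) \<partial>M)"
  proof (rule integral_mono)
    show "integrable M (\<lambda>\<omega>. \<Sum>e\<in>edges G. weight G e * (\<Sum>B\<in>\<B> e. indicator (L e B) \<omega>))"
      using L_sets by (intro Bochner_Integration.integrable_sum integrable_mult_right integrable_real_indicator)
        (auto simp: emeasure_eq_measure)
    \<comment> \<open>The total weight of all edges bounds the output; without integrability the
      expectation would be the default 0.\<close>
    show "integrable M (\<lambda>\<omega>. total_weight G (ALG \<omega>))"
    proof (rule integrable_const_bound)
      show "(\<lambda>\<omega>. total_weight G (ALG \<omega>)) \<in> borel_measurable M"
        unfolding ALG_def using T by (rule total_weight_basic_assignment_measurable)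
      show "AE \<omega> in M. norm (total_weight G (ALG \<omega>)) \<le> total_weight G (edges G)"
        using ALG finite_edges weight_nonneg
        by (auto simp: total_weight_def sum_nonneg subset_iff intro!: AE_I2 sum_mono2)
    qed
    show "(\<Sum>e\<in>edges G. weight G e * (\<Sum>B\<in>\<B> e. indicator (L e B) \<omega>)) \<le> total_weight G (ALG \<omega>)" for \<omega>
      unfolding weight_eq using selected weight_nonneg by (intro sum_mono mult_left_mono)
  qed
  finally show ?thesis
    by (simp add: ALG_def)
qed

end

section \<open>Competitive ratios for general and for optimized thresholds\<close>

lemma basic_assignment_competitive_basic_ratio:
  assumes "0 < p" "p < 1"
  shows "basic_assignment_competitive V W k p (basic_ratio k p)"
  unfolding basic_assignment_competitive_def
proof (intro allI impI)
  fix G :: "'a assignment" and OPT and M :: "'b measure" and T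
  assume inst: "combinatorial_assignment k G" "optimum_choice G OPT" and unif: "uniform_arrivals M (agents G) T"
  interpret assignment_instance k G OPT
    by standard (fact inst)+
  show "(\<forall>\<omega>\<in>space M. feasible G (basic_assignment G OPT p (\<lambda>a. T a \<omega>))) \<and>
      basic_ratio k p * total_weight G (OPT (agents G))
        \<le> (\<integral>\<omega>. total_weight G (basic_assignment G OPT p (\<lambda>a. T a \<omega>)) \<partial>M)"
    using feasible_basic_assignment expected_weight_ge[OF unif assms] by blast
qed

theorem theorem8:
  shows "(\<forall>k\<ge>1. \<forall>p. 0 < p \<and> p < 1 \<longrightarrow>
            basic_assignment_competitive TYPE('v) TYPE('w) k p (basic_ratio k p)) \<and>
         (\<exists>p. 0 < p \<and> p < 1 \<and> basic_ratio 1 p = 1 / exp 1 \<and>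
            basic_assignment_competitive TYPE('v) TYPE('w) 1 p (1 / exp 1)) \<and>
         (\<forall>k\<ge>2. \<exists>p. 0 < p \<and> p < 1 \<and>
            basic_ratio k p = real k powr (- (real k / (real k - 1))) \<and>
            basic_assignment_competitive TYPE('v) TYPE('w) k p
              (real k powr (- (real k / (real k - 1))))) \<and>
         (\<lambda>k::nat. real k powr (- (real k / (real k - 1))) - (1 / real k - ln (real k) / (real k)\<^sup>2))
           \<in> O(\<lambda>k. (ln (real k))\<^sup>2 / (real k) ^ 3)"
proof (intro conjI)
  show "\<forall>k\<ge>1. \<forall>p. 0 < p \<and> p < 1 \<longrightarrow>
      basic_assignment_competitive TYPE('v) TYPE('w) k p (basic_ratio k p)"
    using basic_assignment_competitive_basic_ratio by blast
  \<comment> \<open>The function \<open>- p * ln p\<close> is maximal at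
    \<open>p = 1 / exp 1\<close>, with the same value.\<close>
  have p: "0 < 1 / exp (1 :: real)" "1 / exp (1 :: real) < 1"
    by auto
  moreover have ratio: "basic_ratio 1 (1 / exp 1) = 1 / exp 1"
    using basic_ratio_1[OF p] by (simp add: ln_div)
  ultimately show "\<exists>p. 0 < p \<and> p < 1 \<and> basic_ratio 1 p = 1 / exp 1 \<and>
      basic_assignment_competitive TYPE('v) TYPE('w) 1 p (1 / exp 1)"
    using basic_assignment_competitive_basic_ratio[OF p, of "TYPE('v)" "TYPE('w)" 1]
    by (metis (no_types))
  show "\<forall>k\<ge>2. \<exists>p. 0 < p \<and> p < 1 \<and>
      basic_ratio k p = real k powr (- (real k / (real k - 1))) \<and>
      basic_assignment_competitive TYPE('v) TYPE('w) k p (real k powr (- (real k / (real k - 1))))"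
    using basic_ratio_optimum_ge_2 basic_assignment_competitive_basic_ratio by metis
  \<comment> \<open>The power equals \<open>exp (- ln k / (k - 1)) / k\<close>. The exponent is
    \<open>- ln k / k\<close> up to \<open>O(ln k / k ^ 2)\<close>, and the quadratic term of
    \<open>exp\<close> gives the error \<open>(ln k) ^ 2 / k ^ 3\<close>.\<close>
  show "(\<lambda>k::nat. real k powr (- (real k / (real k - 1))) - (1 / real k - ln (real k) / (real k)\<^sup>2))
      \<in> O(\<lambda>k. (ln (real k))\<^sup>2 / (real k) ^ 3)"
    by real_asymp
qed

end
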